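(* Let $\sigma_g>0$ and let $(\nu_1,\nu_2,\nu_3)$ with $\nu_1\ge\nu_2\ge\nu_3$ be a random vector distributed according to the Gaussian Doroshkevich density with variance parameter $\sigma_g^2$. Define $\lambda_i=e^{\nu_i}-1$ for $i=1,2,3$. Then $(\lambda_1,\lambda_2,\lambda_3)$ has, with respect to Lebesgue measure, the probability density $$\mathcal{N}_{\rm LN}\,\frac{\prod_{i<j}\ln\frac{1+\lambda_i}{1+\lambda_j}}{\prod_{i}(1+\lambda_i)}\exp\left[-\frac{3}{2\sigma_g^2}\left(2J_1^2-5J_2\right)\right]$$ with support $\lambda_1\ge\lambda_2\ge\lambda_3>-1$, where $J_1=\sum_i\ln(1+\lambda_i)$, $J_2=\sum_{i<j}\ln(1+\lambda_i)\ln(1+\lambda_j)$, and the normalization $\mathcal{N}_{\rm LN}=\frac{15^3}{8\pi\sqrt5\,\sigma_g^6}$ is the one of the Gaussian Doroshkevich density with variance parameter $\sigma_g^2$.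
   Context: The Gaussian Doroshkevich density with variance parameter $\sigma^2$ is the probability density on $\{\nu_1\ge\nu_2\ge\nu_3\}\subset\mathbb{R}^3$ given by $$\frac{15^3}{8\pi\sqrt5\,\sigma^6}(\nu_1-\nu_2)(\nu_1-\nu_3)(\nu_2-\nu_3)\exp\left[-\frac{6I_1^2-15I_2}{2\sigma^2}\right],$$ with $I_1=\nu_1+\nu_2+\nu_3$ and $I_2=\nu_1\nu_2+\nu_1\nu_3+\nu_2\nu_3$. In the application, $\sigma_g^2=\ln(1+\sigma_\delta^2)$ with $\sigma_\delta^2>0$ the density variance. *)

theory Defs
  imports "HOL-Probability.Probability"
begin

(* Triples are vectors in real^3; index sums and products are written out because the
   numeral type 3 identifies 3 with 0, so its order does not list the components as 1, 2, 3.
   The parameter \<sigma> of the densities is the square root of the variance parameter. *)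

definition doroshkevich_norm :: "real \<Rightarrow> real" where
  "doroshkevich_norm \<sigma> = 15 ^ 3 / (8 * pi * sqrt 5 * \<sigma> ^ 6)"

definition I1 :: "real ^ 3 \<Rightarrow> real" where
  "I1 v = v $ 1 + v $ 2 + v $ 3"

definition I2 :: "real ^ 3 \<Rightarrow> real" where
  "I2 v = v $ 1 * v $ 2 + v $ 1 * v $ 3 + v $ 2 * v $ 3"

definition doroshkevich_density :: "real \<Rightarrow> real ^ 3 \<Rightarrow> real" where
  "doroshkevich_density \<sigma> v =
     (if v $ 1 \<ge> v $ 2 \<and> v $ 2 \<ge> v $ 3
      then doroshkevich_norm \<sigma>
             * ((v $ 1 - v $ 2) * (v $ 1 - v $ 3) * (v $ 2 - v $ 3))
             * exp (- ((6 * (I1 v)\<^sup>2 - 15 * I2 v) / (2 * \<sigma>\<^sup>2)))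
      else 0)"

definition J1 :: "real ^ 3 \<Rightarrow> real" where
  "J1 l = ln (1 + l $ 1) + ln (1 + l $ 2) + ln (1 + l $ 3)"

definition J2 :: "real ^ 3 \<Rightarrow> real" where
  "J2 l = ln (1 + l $ 1) * ln (1 + l $ 2) + ln (1 + l $ 1) * ln (1 + l $ 3)
          + ln (1 + l $ 2) * ln (1 + l $ 3)"

definition lognormal_doroshkevich_density :: "real \<Rightarrow> real ^ 3 \<Rightarrow> real" where
  "lognormal_doroshkevich_density \<sigma> l =
     (if l $ 1 \<ge> l $ 2 \<and> l $ 2 \<ge> l $ 3 \<and> l $ 3 > - 1
      then doroshkevich_norm \<sigma>
             * ((ln ((1 + l $ 1) / (1 + l $ 2)) * ln ((1 + l $ 1) / (1 + l $ 3))
                   * ln ((1 + l $ 2) / (1 + l $ 3)))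
                / ((1 + l $ 1) * (1 + l $ 2) * (1 + l $ 3)))
             * exp (- (3 / (2 * \<sigma>\<^sup>2)) * (2 * (J1 l)\<^sup>2 - 5 * J2 l))
      else 0)"

end

theory Submission imports Defs begin

text \<open>The map \<open>v \<mapsto> exp v - 1\<close>, taken componentwise, is a smooth injection
  of R^3 onto the set of vectors with all components above -1. Its Jacobian is diagonal, with
  determinant exp(v1) exp(v2) exp(v3), the product of the 1 + l_i at the image point. Logarithms
  undo the exponentials, so the log-normal density at the image of v, times this determinant, is
  exactly the Gaussian density at v (\<open>doroshkevich_density_eq_jacobian_mult\<close>). The
  constant is untouched. The rest is the general transformation rule for densities under injective
  differentiable maps, \<open>distributed_lborel_injective_image\<close>, which rests on the change
  of variables for integrals.\<close>

text \<open>Transfers the change of variables for absolutely integrable functions to nonnegative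
  integrals. Finiteness of the pulled-back integral makes the integrand absolutely integrable, and
  integrability of \<open>h\<close> on the range then comes out as part of the result.\<close>

lemma nn_integral_change_of_variables:
  fixes g :: "real ^ 'n::{finite,wellorder} \<Rightarrow> real ^ 'n::_" and h :: "real ^ 'n::_ \<Rightarrow> real"
  assumes der: "\<And>x. (g has_derivative g' x) (at x)" and inj: "inj g"
    and h: "\<And>y. 0 \<le> h y" "\<And>y. y \<notin> range g \<Longrightarrow> h y = 0"
    and meas: "(\<lambda>x. \<bar>det (matrix (g' x))\<bar> * h (g x)) \<in> borel_measurable borel"
    and fin: "(\<integral>\<^sup>+x. ennreal (\<bar>det (matrix (g' x))\<bar> * h (g x)) \<partial>lborel) < \<infinity>"
  shows "(\<integral>\<^sup>+y. ennreal (h y) \<partial>lborel) = (\<integral>\<^sup>+x. ennreal (\<bar>det (matrix (g' x))\<bar> * h (g x)) \<partial>lborel)"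
proof -
  let ?D = "\<lambda>x. \<bar>det (matrix (g' x))\<bar> * h (g x)"
  obtain r where r: "(\<integral>\<^sup>+x. ennreal (?D x) \<partial>lborel) = ennreal r" "0 \<le> r"
    using fin by (cases "\<integral>\<^sup>+x. ennreal (?D x) \<partial>lborel" rule: ennreal_cases) auto
  have D_int: "(?D has_integral r) UNIV"
    by (rule nn_integral_has_integral[OF meas _ r]) (simp add: h)
  then have D_abs: "?D absolutely_integrable_on UNIV"
    by (intro nonnegative_absolutely_integrable_1) (auto simp: h has_integral_iff)
  \<comment> \<open>The rule used here concerns vector-valued integrands, so scalars are embedded in
    \<open>real ^ 1\<close> by \<open>vec\<close>.\<close>
  have "(\<lambda>x. \<bar>det (matrix (g' x))\<bar> *\<^sub>R (vec (h (g x)) :: real ^ 1)) absolutely_integrable_on UNIV \<and>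
        integral UNIV (\<lambda>x. \<bar>det (matrix (g' x))\<bar> *\<^sub>R (vec (h (g x)) :: real ^ 1)) = vec r
     \<longleftrightarrow> (\<lambda>y. vec (h y) :: real ^ 1) absolutely_integrable_on range g \<and>
        integral (range g) (\<lambda>y. vec (h y) :: real ^ 1) = vec r"
    by (rule has_absolute_integral_change_of_variables) (auto intro: der inj)
  then have "h absolutely_integrable_on range g \<and> integral (range g) h = r"
    using D_int D_abs
    by (simp add: absolutely_integrable_on_1_iff integral_on_1_eq has_integral_iff)
  then have "(h has_integral r) (range g)"
    by (auto simp: has_integral_iff absolutely_integrable_on_def)
  then have "(\<integral>\<^sup>+y. ennreal (h y) * indicator (range g) y \<partial>lborel) = ennreal r"
    by (intro nn_integral_has_integral_lebesgue') (auto simp: h)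
  moreover have "ennreal (h y) * indicator (range g) y = ennreal (h y)" for y
    using h(2)[of y] by (cases "y \<in> range g") auto
  ultimately show ?thesis
    using r by simp
qed

text \<open>The density of \<open>X\<close> is given as the pullback of the target density
  \<open>h\<close>. In this form neither an inverse of \<open>g\<close> nor a division by the
  Jacobian occurs. The two measures are compared on each Borel set \<open>A\<close> by changing
  variables in the integral of \<open>h\<close> over \<open>A\<close>.\<close>

lemma (in prob_space) distributed_lborel_injective_image:
  fixes g :: "real ^ 'n::{finite,wellorder} \<Rightarrow> real ^ 'n::_" and h :: "real ^ 'n::_ \<Rightarrow> real"
  assumes X: "distributed M lborel X (\<lambda>x. ennreal (\<bar>det (matrix (g' x))\<bar> * h (g x)))"
    and der: "\<And>x. (g has_derivative g' x) (at x)" and inj: "inj g"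
    and h: "\<And>y. 0 \<le> h y" "\<And>y. y \<notin> range g \<Longrightarrow> h y = 0"
    and h_meas: "h \<in> borel_measurable borel"
  shows "distributed M lborel (\<lambda>\<omega>. g (X \<omega>)) (\<lambda>y. ennreal (h y))"
  unfolding distributed_def
proof (intro conjI)
  let ?D = "\<lambda>x. \<bar>det (matrix (g' x))\<bar> * h (g x)"
  have cont: "continuous_on UNIV g"
    using der has_derivative_continuous_on[of UNIV g g'] by (metis)
  then have g_meas [measurable]: "g \<in> borel_measurable borel"
    by (rule borel_measurable_continuous_onI)
  note h_meas [measurable]
  have X_meas [measurable]: "X \<in> borel_measurable M"
    using distributed_measurable[OF X] by simp
  have D_meas_enn: "(\<lambda>x. ennreal (?D x)) \<in> borel_measurable borel"
    using distributed_borel_measurable[OF X] by simp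
  \<comment> \<open>Since \<open>?D\<close> is nonnegative, \<open>enn2real\<close> recovers it from
    its \<open>ennreal\<close> version.\<close>
  have D_meas [measurable]: "?D \<in> borel_measurable borel"
    using borel_measurable_enn2real[OF D_meas_enn] by (simp add: h)
  have total: "(\<integral>\<^sup>+x. ennreal (?D x) \<partial>lborel) = 1"
    using distributed_emeasure[OF X, of UNIV] emeasure_space_1 by simp
  show "(\<lambda>\<omega>. g (X \<omega>)) \<in> measurable M lborel"
    by simp
  show "(\<lambda>y. ennreal (h y)) \<in> borel_measurable lborel"
    by simp
  show "distr M lborel (\<lambda>\<omega>. g (X \<omega>)) = density lborel (\<lambda>y. ennreal (h y))"
  proof (rule measure_eqI)
    fix A assume "A \<in> sets (distr M lborel (\<lambda>\<omega>. g (X \<omega>)))"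
    then have A [measurable]: "A \<in> sets borel" by simp
    have gA [measurable]: "g -` A \<in> sets borel"
      using measurable_sets[OF g_meas A] by simp
    let ?h = "\<lambda>y. h y * indicator A y"
    have D_A: "\<bar>det (matrix (g' x))\<bar> * ?h (g x) = ?D x * indicator (g -` A) x" for x
      by (simp add: indicator_def)
    \<comment> \<open>The finiteness needed for the change of variables: the integral is bounded by
      the total mass 1.\<close>
    have "(\<integral>\<^sup>+x. ennreal (?D x * indicator (g -` A) x) \<partial>lborel) \<le> (\<integral>\<^sup>+x. ennreal (?D x) \<partial>lborel)"
      by (intro nn_integral_mono ennreal_leI) (simp add: h indicator_def)
    then have fin: "(\<integral>\<^sup>+x. ennreal (?D x * indicator (g -` A) x) \<partial>lborel) < \<infinity>"
      using total by (simp add: order_le_less_trans)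
    have "emeasure (distr M lborel (\<lambda>\<omega>. g (X \<omega>))) A = emeasure M (X -` (g -` A) \<inter> space M)"
      by (subst emeasure_distr) (auto intro!: arg_cong2[where f = emeasure])
    also have "\<dots> = (\<integral>\<^sup>+x. ennreal (?D x) * indicator (g -` A) x \<partial>lborel)"
      by (rule distributed_emeasure[OF X]) simp
    also have "\<dots> = (\<integral>\<^sup>+x. ennreal (\<bar>det (matrix (g' x))\<bar> * ?h (g x)) \<partial>lborel)"
      by (intro nn_integral_cong) (auto simp: indicator_def)
    also have "\<dots> = (\<integral>\<^sup>+y. ennreal (?h y) \<partial>lborel)"
      by (intro nn_integral_change_of_variables[symmetric] der inj)
        (use h fin in \<open>simp_all only: D_A, auto\<close>)
    also have "\<dots> = (\<integral>\<^sup>+y. ennreal (h y) * indicator A y \<partial>lborel)"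
      by (intro nn_integral_cong) (auto simp: indicator_def)
    also have "\<dots> = emeasure (density lborel (\<lambda>y. ennreal (h y))) A"
      by (subst emeasure_density) auto
    finally show "emeasure (distr M lborel (\<lambda>\<omega>. g (X \<omega>))) A
        = emeasure (density lborel (\<lambda>y. ennreal (h y))) A" .
  qed simp
qed

lemma has_derivative_exp_minus_1_vec:
  fixes v :: "real ^ 'n"
  shows "((\<lambda>v. \<chi> i. exp (v $ i) - 1) has_derivative (\<lambda>w. \<chi> i. exp (v $ i) * w $ i)) (at v)"
proof -
  have *: "((\<lambda>v. exp (v $ i) - 1) has_derivative (\<lambda>w. exp (v $ i) * w $ i)) (at v)" for i
    using bounded_linear_imp_has_derivative[OF bounded_linear_vec_nth, of i "at v"]
    by (auto intro!: derivative_eq_intros)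
  show ?thesis
    by (subst has_derivative_componentwise_within) (auto simp: Basis_vec_def inner_axis *)
qed

lemma det_matrix_scale_components:
  fixes c :: "real ^ 'n"
  shows "det (matrix (\<lambda>w :: real ^ 'n. \<chi> i. c $ i * w $ i)) = (\<Prod>i\<in>UNIV. c $ i)"
  by (subst det_diagonal) (auto simp: matrix_def axis_def)

lemma inj_exp_minus_1_vec: "inj (\<lambda>v :: real ^ 'n. \<chi> i. exp (v $ i) - 1)"
  by (auto simp: inj_def vec_eq_iff)

text \<open>The componentwise inverse is \<open>ln (1 + l $ i)\<close>, defined exactly where every
  component exceeds -1.\<close>

lemma range_exp_minus_1_vec:
  "range (\<lambda>v :: real ^ 'n. \<chi> i. exp (v $ i) - 1) = {l. \<forall>i. l $ i > - 1}"
proof (intro equalityI subsetI)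
  fix l :: "real ^ 'n" assume l: "l \<in> {l. \<forall>i. l $ i > - 1}"
  have "exp (ln (1 + l $ i)) = 1 + l $ i" for i
    proof -
    have "l $ i > - 1"
      using l by blast
    then show ?thesis
      by simp
  qed
  then have "l = (\<chi> i. exp ((\<chi> i. ln (1 + l $ i)) $ i) - 1)"
    by (simp add: vec_eq_iff)
  then show "l \<in> range (\<lambda>v :: real ^ 'n. \<chi> i. exp (v $ i) - 1)"
    by blast
qed auto

text \<open>On the support the ordering makes each of the three ratios at least 1, so their
  logarithms are nonnegative; the norm is nonnegative because \<sigma> enters with an even
  power.\<close>

lemma lognormal_doroshkevich_density_nonneg: "0 \<le> lognormal_doroshkevich_density \<sigma> l"
proof (cases "l $ 1 \<ge> l $ 2 \<and> l $ 2 \<ge> l $ 3 \<and> l $ 3 > - 1")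
  case True
  have "0 \<le> doroshkevich_norm \<sigma>"
    by (simp add: doroshkevich_norm_def)
  with True show ?thesis
    unfolding lognormal_doroshkevich_density_def
    by (auto intro!: mult_nonneg_nonneg divide_nonneg_nonneg ln_ge_zero)
qed (auto simp: lognormal_doroshkevich_density_def)

lemma lognormal_doroshkevich_density_eq_0:
  assumes "\<not> (\<forall>i. l $ i > - 1)"
  shows "lognormal_doroshkevich_density \<sigma> l = 0"
  using assms by (auto simp: forall_3 lognormal_doroshkevich_density_def)

text \<open>The determinant cancels the denominator, each log ratio becomes a difference of
  components of \<open>v\<close>, and \<open>J1\<close>, \<open>J2\<close> become \<open>I1\<close>,
  \<open>I2\<close>. As exp is increasing and positive, the support condition at the image is just
  the ordering of \<open>v\<close>.\<close>

lemma doroshkevich_density_eq_jacobian_mult: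
  "doroshkevich_density \<sigma> v =
     \<bar>det (matrix (\<lambda>w :: real ^ 3. \<chi> i. exp (v $ i) * w $ i))\<bar>
       * lognormal_doroshkevich_density \<sigma> (\<chi> i. exp (v $ i) - 1)"
proof -
  have det: "det (matrix (\<lambda>w :: real ^ 3. \<chi> i. exp (v $ i) * w $ i)) = exp (v $ 1) * exp (v $ 2) * exp (v $ 3)"
  proof -
    have "(\<Prod>i\<in>UNIV. exp (v $ i)) = exp (v $ 1) * exp (v $ 2) * exp (v $ 3)"
      unfolding UNIV_3 by (simp add: mult.assoc)
    then show ?thesis
      using det_matrix_scale_components[of "\<chi> i. exp (v $ i)"] by simp
  qed
  have expo: "- ((6 * (I1 v)\<^sup>2 - 15 * I2 v) / (2 * \<sigma>\<^sup>2))
     = - (3 / (2 * \<sigma>\<^sup>2)) * (2 * (I1 v)\<^sup>2 - 5 * I2 v)"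
    by (simp add: field_simps)
  have J: "J1 (\<chi> i. exp (v $ i) - 1) = I1 v" "J2 (\<chi> i. exp (v $ i) - 1) = I2 v"
    by (simp_all add: J1_def J2_def I1_def I2_def)
  show ?thesis
    unfolding det doroshkevich_density_def lognormal_doroshkevich_density_def expo J
    \<comment> \<open>Quotients of exponentials are folded into one exponential so that
      \<open>ln\<close> cancels it.\<close>
    by (simp add: exp_diff[symmetric] abs_mult)
qed

lemma borel_measurable_lognormal_doroshkevich_density:
  "lognormal_doroshkevich_density \<sigma> \<in> borel_measurable borel"
proof -
  have [measurable]: "(\<lambda>l :: real ^ 3. l $ i) \<in> borel_measurable borel" for i
    by (intro borel_measurable_continuous_onI continuous_intros)
  show ?thesis
    unfolding lognormal_doroshkevich_density_def[abs_def] J1_def J2_def by measurable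
qed

theorem mainTheorem3:
  fixes M :: "'a measure" and \<nu> :: "'a \<Rightarrow> real ^ 3" and \<sigma>\<^sub>g :: real
  assumes "prob_space M"
    and "\<sigma>\<^sub>g > 0"
    and "distributed M lborel \<nu> (\<lambda>v. ennreal (doroshkevich_density \<sigma>\<^sub>g v))"
  shows "distributed M lborel (\<lambda>\<omega>. \<chi> i. exp (\<nu> \<omega> $ i) - 1)
           (\<lambda>l. ennreal (lognormal_doroshkevich_density \<sigma>\<^sub>g l))"
proof -
  interpret prob_space M by fact
  show ?thesis
    \<comment> \<open>Rewriting the given density as Jacobian times target density puts the
      assumption into the form that the transformation rule expects.\<close>
    by (rule distributed_lborel_injective_image
          [where g = "\<lambda>v. \<chi> i. exp (v $ i) - 1" and g' = "\<lambda>v w. \<chi> i. exp (v $ i) * w $ i",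
            OF assms(3)[unfolded doroshkevich_density_eq_jacobian_mult]])
      (auto simp: range_exp_minus_1_vec lognormal_doroshkevich_density_nonneg
        intro: has_derivative_exp_minus_1_vec inj_exp_minus_1_vec
          lognormal_doroshkevich_density_eq_0 borel_measurable_lognormal_doroshkevich_density)
qed

end
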